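(* Let $X_1,\ldots,X_l$ be independent random variables and let $E_1,\ldots,E_m$ be events, each $E_j$ depending only on the variables in its scope $\mathrm{sc}(E_j)\subseteq\{X_1,\ldots,X_l\}$. For each $j$, let $\Gamma_j=\{i\in\{1,\ldots,m\} : E_i \text{ is } d\text{-dependent on } E_j\}$ be the outwards neighborhood of $E_j$ in the $d$-dependency graph. Suppose that there exist numbers $\chi_1,\chi_2,\ldots,\chi_m\in(0,1)$ such that $$\Pr(E_j)\leq \chi_j \prod_{i\in \Gamma_j} (1-\chi_i)\quad\text{for all } j\in\{1,\ldots,m\}.$$ Then $$\Pr\Big[\bigwedge_{j=1}^m\overline{E}_j\Big]>0.$$
   Context: Variable framework: the probability space is the product space of independent random variables $X_1,\ldots,X_l$; each event $E_j$ is determined by the values of a subset $\mathrm{sc}(E_j)$ of these variables, called its scope. An assignment is an assignment of values to $X_1,\ldots,X_l$. Throughout, $\Pr[E_j]<1$ for all $j$. $\overline{E}$ denotes the complement of $E$. $d$-dependency: $E_i$ is $d$-dependent on $E_j$ if there exists an assignment $\alpha$ under which $E_j$ occurs and $E_i$ does not, and such that the values of the variables in $\mathrm{sc}(E_j)$ can be changed (all other values of $\alpha$ being kept) so that $E_i$ occurs and $E_j$ ceases occurring. The $d$-dependency graph is the simple directed graph on $\{1,\ldots,m\}$ with an edge $(j,i)$ whenever $E_i$ is $d$-dependent on $E_j$. *)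

theory Defs
  imports "HOL-Probability.Probability"
begin

text \<open>
  The variable indexed by \<open>x \<in> I\<close> has the distribution \<open>M x\<close>, and an assignment is a point of the
  product space \<open>PiM I M\<close>. Distinct variables may have distinct value spaces \<open>space (M x)\<close>, all
  inside one common type. A scope need not be the least set of variables determining its event.
\<close>

definition determined_by ::
    "('x \<Rightarrow> 'a) measure \<Rightarrow> ('x \<Rightarrow> 'a) set \<Rightarrow> 'x set \<Rightarrow> bool" where
  "determined_by P A S \<longleftrightarrow>
     (\<forall>\<alpha>\<in>space P. \<forall>\<beta>\<in>space P. (\<forall>x\<in>S. \<alpha> x = \<beta> x) \<longrightarrow> (\<alpha> \<in> A \<longleftrightarrow> \<beta> \<in> A))"

text \<open>
  In \<open>d_dependent I M sc E i j\<close>, the event \<open>E i\<close> is d-dependent on \<open>E j\<close>; the corresponding edge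
  of the d-dependency graph goes from \<open>j\<close> to \<open>i\<close>. The quantifiers range over all assignments,
  including those of probability zero.
\<close>

definition d_dependent ::
    "'x set \<Rightarrow> ('x \<Rightarrow> 'a measure) \<Rightarrow> ('e \<Rightarrow> 'x set) \<Rightarrow> ('e \<Rightarrow> ('x \<Rightarrow> 'a) set) \<Rightarrow> 'e \<Rightarrow> 'e \<Rightarrow> bool" where
  "d_dependent I M sc E i j \<longleftrightarrow>
     (\<exists>\<alpha>\<in>space (PiM I M). \<alpha> \<in> E j \<and> \<alpha> \<notin> E i \<and>
       (\<exists>\<beta>\<in>space (PiM I M). (\<forall>x\<in>I - sc j. \<beta> x = \<alpha> x) \<and> \<beta> \<in> E i \<and> \<beta> \<notin> E j))"

definition d_out_neighborhood ::
    "'x set \<Rightarrow> ('x \<Rightarrow> 'a measure) \<Rightarrow> 'e set \<Rightarrow> ('e \<Rightarrow> 'x set) \<Rightarrow> ('e \<Rightarrow> ('x \<Rightarrow> 'a) set) \<Rightarrow> 'e \<Rightarrow> 'e set" where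
  "d_out_neighborhood I M J sc E j = {i\<in>J. d_dependent I M sc E i j}"

end

theory Submission imports Defs begin

text \<open>
  The outwards d-neighborhoods satisfy the hypothesis of the directed lopsided local lemma. Fix the
  variables outside \<open>sc j\<close>, and let \<open>B\<close> be the event that no \<open>E i\<close> with \<open>i \<in> S\<close> occurs, where \<open>S\<close>
  avoids \<open>\<Gamma> j\<close>. If some completion of the fixed values lies in \<open>E j \<inter> B\<close>, then every completion
  outside \<open>E j\<close> lies in \<open>B\<close>. So the section of \<open>B\<close> either misses \<open>E j\<close> or contains its complement,
  and in both cases \<open>E j\<close> and \<open>B\<close> are negatively correlated on that section. Integrating over the
  fixed variables gives \<open>\<P>(E j \<inter> B) \<le> \<P>(E j) \<P>(B)\<close>.
\<close>

lemma sets_Collect_avoid: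
  assumes "finite U" "\<And>i. i \<in> U \<Longrightarrow> E i \<in> sets M"
  shows "{w \<in> space M. \<forall>i\<in>U. w \<notin> E i} \<in> sets M"
proof -
  have "{w \<in> space M. \<forall>i\<in>U. w \<notin> E i} = space M - (\<Union>i\<in>U. E i)" by auto
  then show ?thesis using assms by (auto intro!: sets.Diff sets.finite_UN)
qed

context prob_space
begin

text \<open>This is the chain rule with conditional probabilities multiplied out, so null
  conditioning events need no separate treatment. The events of \<open>T\<close> are added one at a
  time, and by \<open>step\<close> each addition keeps at least the fraction
  \<open>1 - chi t\<close> of the avoidance probability.\<close>

lemma prod_le_prob_avoid_Un:
  assumes "finite T" "finite S" "S \<inter> T = {}"
    and ev: "\<And>i. i \<in> S \<union> T \<Longrightarrow> E i \<in> events"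
    and chi: "\<And>t. t \<in> T \<Longrightarrow> chi t \<le> 1"
    and step: "\<And>U t. S \<subseteq> U \<Longrightarrow> t \<in> T \<Longrightarrow> t \<notin> U \<Longrightarrow> U \<subseteq> S \<union> T \<Longrightarrow>
        prob (E t \<inter> {w \<in> space M. \<forall>i\<in>U. w \<notin> E i}) \<le> chi t * prob {w \<in> space M. \<forall>i\<in>U. w \<notin> E i}"
  shows "(\<Prod>t\<in>T. 1 - chi t) * prob {w \<in> space M. \<forall>i\<in>S. w \<notin> E i}
    \<le> prob {w \<in> space M. \<forall>i\<in>S \<union> T. w \<notin> E i}"
  using \<open>finite T\<close> \<open>S \<inter> T = {}\<close> ev chi step
proof (induction T)
  case empty
  then show ?case by simp
next
  case (insert t T)
  let ?N = "\<lambda>U. {w \<in> space M. \<forall>i\<in>U. w \<notin> E i}"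
  have IH: "(\<Prod>t\<in>T. 1 - chi t) * prob (?N S) \<le> prob (?N (S \<union> T))"
    by (rule insert.IH) (use insert.prems in blast)+
  have ct: "chi t \<le> 1" using insert.prems(3) by simp
  have tn: "t \<notin> S \<union> T" using insert.hyps insert.prems(1) by auto
  have meas: "?N (S \<union> T) \<in> events"
    using insert.prems(2) \<open>finite S\<close> insert.hyps(1) by (intro sets_Collect_avoid) auto
  have Et: "E t \<in> events" using insert.prems(2) by simp
  have "(\<Prod>t\<in>insert t T. 1 - chi t) * prob (?N S) = (1 - chi t) * ((\<Prod>t\<in>T. 1 - chi t) * prob (?N S))"
    using insert.hyps by simp
  also have "\<dots> \<le> (1 - chi t) * prob (?N (S \<union> T))"
    using IH ct by (intro mult_left_mono) auto
  also have "\<dots> \<le> prob (?N (S \<union> T)) - prob (E t \<inter> ?N (S \<union> T))"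
    using insert.prems(4)[of "S \<union> T" t] tn by (auto simp: algebra_simps)
  also have "\<dots> = prob (?N (S \<union> T) - E t \<inter> ?N (S \<union> T))"
    using meas Et by (intro finite_measure_Diff[symmetric]) auto
  also have "?N (S \<union> T) - E t \<inter> ?N (S \<union> T) = ?N (S \<union> insert t T)"
    by auto
  finally show ?case .
qed

text \<open>The classical induction on the number of avoided events still works here: independence
  from the events outside \<open>\<Gamma> j\<close> enters only as an upper bound, which
  \<open>neg_corr\<close> supplies.\<close>

lemma lopsided_local_lemma:
  assumes fin: "finite J"
    and ev: "\<And>j. j \<in> J \<Longrightarrow> E j \<in> events"
    and chi: "\<And>j. j \<in> J \<Longrightarrow> 0 < chi j \<and> chi j < 1"
    and \<Gamma>: "\<And>j. j \<in> J \<Longrightarrow> \<Gamma> j \<subseteq> J"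
    and neg_corr: "\<And>j S. j \<in> J \<Longrightarrow> S \<subseteq> J - \<Gamma> j - {j} \<Longrightarrow>
        prob (E j \<inter> {w \<in> space M. \<forall>i\<in>S. w \<notin> E i}) \<le> prob (E j) * prob {w \<in> space M. \<forall>i\<in>S. w \<notin> E i}"
    and bound: "\<And>j. j \<in> J \<Longrightarrow> prob (E j) \<le> chi j * (\<Prod>i\<in>\<Gamma> j. 1 - chi i)"
  shows "(\<Prod>j\<in>J. 1 - chi j) \<le> prob {w \<in> space M. \<forall>j\<in>J. w \<notin> E j}"
proof -
  let ?N = "\<lambda>U. {w \<in> space M. \<forall>i\<in>U. w \<notin> E i}"
  have meas: "?N U \<in> events" if "U \<subseteq> J" for U
    using that ev fin by (intro sets_Collect_avoid) (auto intro: finite_subset)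
  \<comment> \<open>Where \<open>?N S\<close> is not null, this says that \<open>E j\<close> has
    conditional probability at most \<open>chi j\<close> given \<open>?N S\<close>.\<close>
  have key: "prob (E j \<inter> ?N S) \<le> chi j * prob (?N S)" if "S \<subseteq> J" "j \<in> J - S" for S j
    using that
  proof (induction "card S" arbitrary: S j rule: less_induct)
    case less
    have finS: "finite S" using less.prems fin finite_subset by blast
    have j: "j \<in> J" using less.prems by simp
    let ?T = "S \<inter> \<Gamma> j" and ?R = "S - \<Gamma> j"
    have prod_mono: "(\<Prod>i\<in>\<Gamma> j. 1 - chi i) \<le> (\<Prod>i\<in>?T. 1 - chi i)"
    proof -
      have "finite (\<Gamma> j)" using \<Gamma>[OF j] fin finite_subset by blast
      then have "(\<Prod>i\<in>\<Gamma> j. 1 - chi i) = (\<Prod>i\<in>\<Gamma> j - ?T. 1 - chi i) * (\<Prod>i\<in>?T. 1 - chi i)"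
        by (rule prod.subset_diff[rotated]) simp
      also have "\<dots> \<le> (\<Prod>i\<in>?T. 1 - chi i)"
        using \<Gamma>[OF j] chi
        by (intro mult_left_le_one_le prod_nonneg prod_le_1) (auto simp: less_imp_le subset_iff)
      finally show ?thesis .
    qed
    \<comment> \<open>Forgetting the neighbors of \<open>j\<close> enlarges the event and leaves
      only indices to which \<open>neg_corr\<close> applies. The product in \<open>bound\<close>
      then pays for bringing the neighbors in \<open>?T\<close> back.\<close>
    have "prob (E j \<inter> ?N S) \<le> prob (E j \<inter> ?N ?R)"
      using ev j meas[of ?R] less.prems by (intro finite_measure_mono) auto
    also have "\<dots> \<le> prob (E j) * prob (?N ?R)"
      using less.prems by (intro neg_corr) auto
    also have "\<dots> \<le> chi j * (\<Prod>i\<in>?T. 1 - chi i) * prob (?N ?R)"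
      using bound[OF j] chi[OF j] prod_mono
      by (intro mult_right_mono) (auto intro: order_trans mult_left_mono)
    also have "\<dots> \<le> chi j * prob (?N (?R \<union> ?T))"
    proof -
      have "(\<Prod>i\<in>?T. 1 - chi i) * prob (?N ?R) \<le> prob (?N (?R \<union> ?T))"
      proof (rule prod_le_prob_avoid_Un)
        fix U t
        assume U: "?R \<subseteq> U" "t \<in> ?T" "t \<notin> U" "U \<subseteq> ?R \<union> ?T"
        \<comment> \<open>The inclusion is strict because \<open>t\<close> lies in \<open>S\<close>
          but not in \<open>U\<close>, so the induction hypothesis covers \<open>U\<close>.\<close>
        then have "U \<subset> S" by blast
        then show "prob (E t \<inter> ?N U) \<le> chi t * prob (?N U)"
          using U less.prems finS by (intro less.hyps) (auto intro: psubset_card_mono)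
      qed (use finS ev chi less.prems in \<open>auto intro: less_imp_le\<close>)
      then show ?thesis using chi[OF j] by (simp add: mult.assoc)
    qed
    also have "?R \<union> ?T = S" by blast
    finally show ?case .
  qed
  \<comment> \<open>The chain starts from the empty set, where \<open>?N {}\<close> is the whole
    space and has probability 1.\<close>
  have "(\<Prod>j\<in>J. 1 - chi j) * prob (?N {}) \<le> prob (?N ({} \<union> J))"
    by (rule prod_le_prob_avoid_Un) (use fin ev chi key in \<open>auto intro: less_imp_le\<close>)
  then show ?thesis by (simp add: prob_space)
qed

end

text \<open>The first factor carries the variables that stay fixed, the second those that are
  changed. All sections of \<open>A\<close> over the first factor coincide, so their common measure
  is a constant that leaves the integral of the sectionwise inequality.\<close>

lemma pair_prob_neg_correlated:
  assumes "prob_space M1" "prob_space M2"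
    and A: "A \<in> sets (M1 \<Otimes>\<^sub>M M2)" and B: "B \<in> sets (M1 \<Otimes>\<^sub>M M2)"
    and snd_only: "\<And>z z' y. z \<in> space M1 \<Longrightarrow> z' \<in> space M1 \<Longrightarrow> y \<in> space M2 \<Longrightarrow> (z, y) \<in> A \<Longrightarrow> (z', y) \<in> A"
    and sections: "\<And>z y y'. z \<in> space M1 \<Longrightarrow> y \<in> space M2 \<Longrightarrow> y' \<in> space M2 \<Longrightarrow>
        (z, y) \<in> A \<Longrightarrow> (z, y) \<in> B \<Longrightarrow> (z, y') \<notin> A \<Longrightarrow> (z, y') \<in> B"
  shows "measure (M1 \<Otimes>\<^sub>M M2) (A \<inter> B) \<le> measure (M1 \<Otimes>\<^sub>M M2) A * measure (M1 \<Otimes>\<^sub>M M2) B"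
proof -
  interpret M1: prob_space M1 by fact
  interpret M2: prob_space M2 by fact
  interpret P: pair_prob_space M1 M2 ..
  obtain z0 where z0: "z0 \<in> space M1" using M1.not_empty by blast
  define a where "a = emeasure M2 (Pair z0 -` A)"
  have sub: "A \<subseteq> space M1 \<times> space M2"
    using sets.sets_into_space[OF A] by (simp add: space_pair_measure)
  have sect: "Pair z -` A = Pair z0 -` A" if "z \<in> space M1" for z
    using snd_only[OF that z0] snd_only[OF z0 that] sub by blast
  have emA: "emeasure (M1 \<Otimes>\<^sub>M M2) A = a"
  proof -
    have "emeasure (M1 \<Otimes>\<^sub>M M2) A = (\<integral>\<^sup>+ z. emeasure M2 (Pair z -` A) \<partial>M1)"
      by (rule M2.emeasure_pair_measure_alt[OF A])
    also have "\<dots> = (\<integral>\<^sup>+ z. a \<partial>M1)"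
      by (rule nn_integral_cong) (simp add: sect a_def)
    finally show ?thesis by (simp add: M1.emeasure_space_1)
  qed
  have ptwise: "emeasure M2 (Pair z -` (A \<inter> B)) \<le> a * emeasure M2 (Pair z -` B)"
    if z: "z \<in> space M1" for z
  proof -
    let ?A = "Pair z -` A" and ?B = "Pair z -` B"
    have mA: "?A \<in> sets M2" and mB: "?B \<in> sets M2" using A B by (auto intro: sets_Pair1)
    have aA: "a = emeasure M2 ?A" using sect[OF z] by (simp add: a_def)
    have "M2.prob (?A \<inter> ?B) \<le> M2.prob ?A * M2.prob ?B"
    proof (cases "?A \<inter> ?B = {}")
      case False
      then have "space M2 - ?A \<subseteq> ?B"
        using sections[OF z] sub by blast
      then have "?B = (space M2 - ?A) \<union> (?A \<inter> ?B)"
        using sets.sets_into_space[OF mB] by blast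
      then have "M2.prob ?B = M2.prob (space M2 - ?A) + M2.prob (?A \<inter> ?B)"
        using mA mB by (metis M2.finite_measure_Union Diff_disjoint Int_assoc Int_commute
          inf_bot_left sets.Int sets.compl_sets)
      then have B_eq: "M2.prob ?B = 1 - M2.prob ?A + M2.prob (?A \<inter> ?B)"
        using M2.prob_compl[OF mA] by simp
      \<comment> \<open>Let \<open>p\<close> and \<open>q\<close> be the probabilities of
        \<open>?A\<close> and \<open>?A \<inter> ?B\<close>. Then \<open>?B\<close> has probability
        \<open>1 - p + q\<close>, and the goal \<open>q \<le> p * (1 - p + q)\<close> rearranges to
        \<open>q * (1 - p) \<le> p * (1 - p)\<close>, which follows from
        \<open>q \<le> p\<close>.\<close>
      moreover have "M2.prob (?A \<inter> ?B) * (1 - M2.prob ?A) \<le> M2.prob ?A * (1 - M2.prob ?A)"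
        using mA by (intro mult_right_mono M2.finite_measure_mono) auto
      ultimately have "M2.prob (?A \<inter> ?B) \<le> M2.prob ?A * (1 - M2.prob ?A + M2.prob (?A \<inter> ?B))"
        by (simp add: algebra_simps)
      then show ?thesis using B_eq by simp
    qed simp
    then show ?thesis
      unfolding aA M2.emeasure_eq_measure vimage_Int by (simp add: ennreal_mult[symmetric])
  qed
  have "emeasure (M1 \<Otimes>\<^sub>M M2) (A \<inter> B) = (\<integral>\<^sup>+ z. emeasure M2 (Pair z -` (A \<inter> B)) \<partial>M1)"
    using A B by (intro M2.emeasure_pair_measure_alt) auto
  also have "\<dots> \<le> (\<integral>\<^sup>+ z. a * emeasure M2 (Pair z -` B) \<partial>M1)"
    by (rule nn_integral_mono) (rule ptwise)
  also have "\<dots> = a * emeasure (M1 \<Otimes>\<^sub>M M2) B"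
    using B by (simp add: nn_integral_cmult M2.measurable_emeasure_Pair M2.emeasure_pair_measure_alt)
  finally show ?thesis
    unfolding emA[symmetric] P.emeasure_eq_measure by (simp add: ennreal_mult[symmetric])
qed

text \<open>Merging assignments on \<open>I - S\<close> and on \<open>S\<close> preserves measure,
  so the claim reduces to a product of two factors. Determination by \<open>S\<close> makes the
  sections of \<open>A\<close> constant, and \<open>change\<close> becomes the condition on the
  sections of \<open>B\<close>.\<close>

lemma PiM_neg_correlated:
  assumes fin: "finite I" and prob: "\<And>x. x \<in> I \<Longrightarrow> prob_space (M x)" and "S \<subseteq> I"
    and A: "A \<in> sets (PiM I M)" and B: "B \<in> sets (PiM I M)"
    and det: "determined_by (PiM I M) A S"
    and change: "\<And>\<alpha> \<beta>. \<alpha> \<in> space (PiM I M) \<Longrightarrow> \<beta> \<in> space (PiM I M) \<Longrightarrow> (\<forall>x\<in>I - S. \<beta> x = \<alpha> x) \<Longrightarrow>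
        \<alpha> \<in> A \<Longrightarrow> \<alpha> \<in> B \<Longrightarrow> \<beta> \<notin> A \<Longrightarrow> \<beta> \<in> B"
  shows "measure (PiM I M) (A \<inter> B) \<le> measure (PiM I M) A * measure (PiM I M) B"
proof -
  \<comment> \<open>\<open>product_prob_space\<close> asks for a probability space at every index, also outside \<open>I\<close>.\<close>
  define M' where "M' x = (if x \<in> I then M x else return (count_space UNIV) undefined)" for x
  have M_M': "PiM I M = PiM I M'" by (rule PiM_cong) (simp_all add: M'_def)
  have "prob_space (M' x)" for x
    by (simp add: M'_def prob prob_space_return)
  then interpret product_prob_space M' I
    by (rule product_prob_spaceI)
  let ?Z = "PiM (I - S) M'" and ?Y = "PiM S M'" and ?mg = "merge (I - S) S"
  let ?P = "?Z \<Otimes>\<^sub>M ?Y"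
  let ?pre = "\<lambda>X. ?mg -` X \<inter> space ?P"
  have Un: "I - S \<union> S = I" using \<open>S \<subseteq> I\<close> by auto
  have mg: "?mg \<in> measurable ?P (PiM I M')"
    using measurable_merge[of "I - S" S M'] Un by simp
  have "distr ?P (PiM I M') ?mg = PiM I M'"
    using distr_merge[of "I - S" S] fin \<open>S \<subseteq> I\<close> Un by (auto intro: finite_subset)
  then have meq: "measure (PiM I M) X = measure ?P (?pre X)" if "X \<in> sets (PiM I M)" for X
    using measure_distr[OF mg, of X] that unfolding M_M' by simp
  have mem: "?mg (z, y) \<in> space (PiM I M)" if "z \<in> space ?Z" "y \<in> space ?Y" for z y
    using measurable_space[OF mg, of "(z, y)"] that by (simp add: M_M' space_pair_measure)
  have "measure ?P (?pre A \<inter> ?pre B) \<le> measure ?P (?pre A) * measure ?P (?pre B)"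
  proof (rule pair_prob_neg_correlated)
    show "?pre A \<in> sets ?P" "?pre B \<in> sets ?P"
      using A B mg M_M' by (auto intro: measurable_sets)
    show "prob_space ?Z" "prob_space ?Y"
      by (auto intro!: prob_space_PiM M.prob_space_axioms)
  next
    fix z z' y
    assume *: "z \<in> space ?Z" "z' \<in> space ?Z" "y \<in> space ?Y" "(z, y) \<in> ?pre A"
    have "\<forall>x\<in>S. ?mg (z, y) x = ?mg (z', y) x" by (auto simp: merge_def)
    then have "?mg (z, y) \<in> A \<longleftrightarrow> ?mg (z', y) \<in> A"
      using * det mem unfolding determined_by_def by blast
    then show "(z', y) \<in> ?pre A" using * by (simp add: space_pair_measure)
  next
    fix z y y'
    assume *: "z \<in> space ?Z" "y \<in> space ?Y" "y' \<in> space ?Y"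
      "(z, y) \<in> ?pre A" "(z, y) \<in> ?pre B" "(z, y') \<notin> ?pre A"
    \<comment> \<open>The two merged assignments share \<open>z\<close>, hence agree on
      \<open>I - S\<close>, as \<open>change\<close> demands.\<close>
    have "?mg (z, y') \<in> B"
      by (rule change[of "?mg (z, y)"])
        (use * mem in \<open>auto simp: merge_def space_pair_measure\<close>)
    then show "(z, y') \<in> ?pre B" using * by (simp add: space_pair_measure)
  qed
  moreover have "?pre (A \<inter> B) = ?pre A \<inter> ?pre B" by auto
  ultimately show ?thesis using A B by (simp add: meq sets.Int)
qed

theorem theorem1:
  fixes l m :: nat
    and M :: "nat \<Rightarrow> 'a measure"
    and sc :: "nat \<Rightarrow> nat set"
    and E :: "nat \<Rightarrow> (nat \<Rightarrow> 'a) set"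
    and chi :: "nat \<Rightarrow> real"
  assumes "\<And>x. x \<in> {1..l} \<Longrightarrow> prob_space (M x)"
    and "\<And>j. j \<in> {1..m} \<Longrightarrow> E j \<in> sets (PiM {1..l} M)"
    and "\<And>j. j \<in> {1..m} \<Longrightarrow> sc j \<subseteq> {1..l}"
    and "\<And>j. j \<in> {1..m} \<Longrightarrow> determined_by (PiM {1..l} M) (E j) (sc j)"
    and "\<And>j. j \<in> {1..m} \<Longrightarrow> measure (PiM {1..l} M) (E j) < 1"
    and "\<And>j. j \<in> {1..m} \<Longrightarrow> 0 < chi j \<and> chi j < 1"
    and "\<And>j. j \<in> {1..m} \<Longrightarrow> measure (PiM {1..l} M) (E j)
           \<le> chi j * (\<Prod>i\<in>d_out_neighborhood {1..l} M {1..m} sc E j. 1 - chi i)"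
  shows "\<P>(\<alpha> in PiM {1..l} M. \<forall>j\<in>{1..m}. \<alpha> \<notin> E j) > 0"
proof -
  let ?P = "PiM {1..l} M" and ?\<Gamma> = "d_out_neighborhood {1..l} M {1..m} sc E"
  interpret prob_space ?P by (rule prob_space_PiM) (rule assms(1))
  have "(\<Prod>j\<in>{1..m}. 1 - chi j) \<le> prob {\<alpha> \<in> space ?P. \<forall>j\<in>{1..m}. \<alpha> \<notin> E j}"
  proof (rule lopsided_local_lemma[where \<Gamma> = ?\<Gamma>])
    fix j S
    assume j: "j \<in> {1..m}" and S: "S \<subseteq> {1..m} - ?\<Gamma> j - {j}"
    let ?N = "{\<alpha> \<in> space ?P. \<forall>i\<in>S. \<alpha> \<notin> E i}"
    show "prob (E j \<inter> ?N) \<le> prob (E j) * prob ?N"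
    proof (rule PiM_neg_correlated[where S = "sc j"])
      show "?N \<in> events"
        using S assms(2) by (intro sets_Collect_avoid) (auto intro: finite_subset)
    next
      fix \<alpha> \<beta>
      assume *: "\<alpha> \<in> space ?P" "\<beta> \<in> space ?P" "\<forall>x\<in>{1..l} - sc j. \<beta> x = \<alpha> x"
        "\<alpha> \<in> E j" "\<alpha> \<in> ?N" "\<beta> \<notin> E j"
      \<comment> \<open>Otherwise the passage from \<open>\<alpha>\<close> to
        \<open>\<beta>\<close>, which alters only variables in \<open>sc j\<close>, would witness
        that \<open>E i\<close> is d-dependent on \<open>E j\<close>, putting \<open>i\<close> into
        the neighborhood that \<open>S\<close> avoids.\<close>
      have "\<beta> \<notin> E i" if "i \<in> S" for i
      proof
        assume "\<beta> \<in> E i"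
        moreover have "\<alpha> \<notin> E i" using * that by blast
        ultimately have "d_dependent {1..l} M sc E i j"
          unfolding d_dependent_def using * by blast
        then show False using S that unfolding d_out_neighborhood_def by blast
      qed
      then show "\<beta> \<in> ?N" using * by blast
    qed (use j assms in auto)
  qed (use assms in \<open>auto simp: d_out_neighborhood_def\<close>)
  moreover have "0 < (\<Prod>j\<in>{1..m}. 1 - chi j)"
    using assms(6) by (intro prod_pos) simp
  ultimately show ?thesis by linarith
qed

end
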